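(* Let $r \ge 2$ be an integer. Suppose that $\mathcal{F}$ is a degenerate family of $r$-graphs satisfying $\mathrm{ex}(n,\mathcal{F}) = O(n^{1+\alpha})$ for some constant $\alpha$ with $r-2\le \alpha < r-1$. Then $$\mathrm{ex}_{p_{\ast}}(n,\mathcal{F}) = O\left(n^{p_{\ast}(r-1)} \log n\right), \quad\text{where}\quad p_{\ast}:= \frac{1}{r-1-\alpha}.$$
   Context: For an integer $r\ge 2$, an $r$-graph $\mathcal{H}$ is a finite $r$-uniform hypergraph, identified with its edge set, with vertex set $V(\mathcal{H})$. The degree $d_{\mathcal{H}}(v)$ is the number of edges containing $v$. For a real $p\ge 0$, $\|\mathcal{H}\|_p := \sum_{v\in V(\mathcal{H})} (d_{\mathcal{H}}(v))^{p}$. Given a family $\mathcal{F}$ of $r$-graphs, an $r$-graph is $\mathcal{F}$-free if it contains no member of $\mathcal{F}$ as a (not necessarily induced) subgraph. $\mathrm{ex}(n,\mathcal{F})$ is the maximum number of edges of an $n$-vertex $\mathcal{F}$-free $r$-graph, and $\mathrm{ex}_p(n,\mathcal{F})$ is the maximum of $\|\mathcal{H}\|_p$ over all $n$-vertex $\mathcal{F}$-free $r$-graphs $\mathcal{H}$. The family $\mathcal{F}$ is degenerate if $\lim_{n\to\infty}\mathrm{ex}(n,\mathcal{F})/\binom{n}{r}=0$. The base of $\log$ is $2$, and asymptotic notation is with respect to $n\to\infty$. *)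

theory Defs
  imports "HOL-Analysis.Analysis" "HOL-Library.Landau_Symbols"
begin

text \<open>A hypergraph is a pair of a vertex set and an edge set; isolated vertices are allowed.\<close>

type_synonym 'a hypergraph = "'a set \<times> 'a set set"

abbreviation verts :: "'a hypergraph \<Rightarrow> 'a set" where
  "verts H \<equiv> fst H"

abbreviation edges :: "'a hypergraph \<Rightarrow> 'a set set" where
  "edges H \<equiv> snd H"

definition r_graph :: "nat \<Rightarrow> 'a hypergraph \<Rightarrow> bool" where
  "r_graph r H \<longleftrightarrow> finite (verts H) \<and> (\<forall>e\<in>edges H. e \<subseteq> verts H \<and> card e = r)"

definition degree :: "'a hypergraph \<Rightarrow> 'a \<Rightarrow> nat" where
  "degree H v = card {e \<in> edges H. v \<in> e}"

text \<open>Since \<open>0 powr p = 0\<close> also for \<open>p = 0\<close>, isolated vertices contribute \<open>0\<close> for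
  every exponent; for \<open>p > 0\<close> this is the usual power.\<close>

definition degree_norm :: "real \<Rightarrow> 'a hypergraph \<Rightarrow> real" where
  "degree_norm p H = (\<Sum>v\<in>verts H. real (degree H v) powr p)"

text \<open>Not necessarily induced copy of \<open>F\<close> in \<open>H\<close>.\<close>

definition contains_copy :: "'b hypergraph \<Rightarrow> 'a hypergraph \<Rightarrow> bool" where
  "contains_copy H F \<longleftrightarrow>
     (\<exists>f. inj_on f (verts F) \<and> f ` verts F \<subseteq> verts H \<and> (\<forall>e\<in>edges F. f ` e \<in> edges H))"

definition family_free :: "'a hypergraph set \<Rightarrow> 'b hypergraph \<Rightarrow> bool" where
  "family_free \<F> H \<longleftrightarrow> (\<forall>F\<in>\<F>. \<not> contains_copy H F)"

text \<open>Host graphs have natural numbers as vertices, which loses nothing up to isomorphism.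
  The maxima below range over finite sets of values (see the two lemmas). They range over the
  empty set only when some member of the family is edgeless and has at most \<open>n\<close> vertices;
  the value \<open>Max {}\<close> is then a constant independent of \<open>n\<close>.\<close>

definition free_graphs :: "nat \<Rightarrow> nat \<Rightarrow> 'a hypergraph set \<Rightarrow> nat hypergraph set" where
  "free_graphs r n \<F> = {H. r_graph r H \<and> card (verts H) = n \<and> family_free \<F> H}"

definition ex :: "nat \<Rightarrow> nat \<Rightarrow> 'a hypergraph set \<Rightarrow> nat" where
  "ex r n \<F> = Max ((\<lambda>H. card (edges H)) ` free_graphs r n \<F>)"

definition ex_norm :: "nat \<Rightarrow> real \<Rightarrow> nat \<Rightarrow> 'a hypergraph set \<Rightarrow> real" where
  "ex_norm r p n \<F> = Max (degree_norm p ` free_graphs r n \<F>)"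

definition degenerate :: "nat \<Rightarrow> 'a hypergraph set \<Rightarrow> bool" where
  "degenerate r \<F> \<longleftrightarrow> (\<lambda>n. real (ex r n \<F>) / real (n choose r)) \<longlonglongrightarrow> 0"

lemma r_graph_finite_edges:
  assumes "r_graph r H"
  shows "finite (edges H)" and "card (edges H) \<le> 2 ^ card (verts H)"
proof -
  have *: "edges H \<subseteq> Pow (verts H)" and fin: "finite (verts H)"
    using assms by (auto simp: r_graph_def)
  then show "finite (edges H)"
    using finite_subset by blast
  show "card (edges H) \<le> 2 ^ card (verts H)"
    using card_mono[OF _ *] fin by (simp add: card_Pow)
qed

lemma finite_edge_counts: "finite ((\<lambda>H. card (edges H)) ` free_graphs r n \<F>)"
proof (rule finite_subset)
  show "(\<lambda>H. card (edges H)) ` free_graphs r n \<F> \<subseteq> {..2 ^ n}"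
    using r_graph_finite_edges(2) by (fastforce simp: free_graphs_def)
qed simp

lemma finite_degree_norms: "finite (degree_norm p ` free_graphs r n \<F>)"
proof (rule finite_subset)
  let ?L = "{ds. set ds \<subseteq> {..2 ^ n :: nat} \<and> length ds = n}"
  show "degree_norm p ` free_graphs r n \<F> \<subseteq> (\<lambda>ds. \<Sum>d\<leftarrow>ds. real d powr p) ` ?L"
  proof (rule image_subsetI)
    fix H assume "H \<in> free_graphs r n \<F>"
    then have H: "r_graph r H" and n: "card (verts H) = n"
      by (auto simp: free_graphs_def)
    have "finite (verts H)"
      using H by (simp add: r_graph_def)
    then obtain vs where vs: "set vs = verts H" "distinct vs"
      using finite_distinct_list by blast
    have "degree H v \<le> 2 ^ n" for v
    proof -
      have "degree H v \<le> card (edges H)"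
        unfolding degree_def by (rule card_mono) (auto simp: r_graph_finite_edges(1)[OF H])
      then show ?thesis
        using r_graph_finite_edges(2)[OF H] n by simp
    qed
    moreover have "length vs = n"
      using vs n distinct_card by fastforce
    ultimately have "map (degree H) vs \<in> ?L"
      by auto
    moreover have "degree_norm p H = (\<Sum>d\<leftarrow>map (degree H) vs. real d powr p)"
      unfolding degree_norm_def vs(1)[symmetric]
      by (simp add: sum.distinct_set_conv_list[OF vs(2)] o_def)
    ultimately show "degree_norm p H \<in> (\<lambda>ds. \<Sum>d\<leftarrow>ds. real d powr p) ` ?L"
      by blast
  qed
  show "finite ((\<lambda>ds. \<Sum>d\<leftarrow>ds. real d powr p) ` ?L)"
    by (intro finite_imageI finite_lists_length_eq) simp
qed

end

theory Submission
  imports Defs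
begin

text \<open>
  The argument is a weak-type estimate for the degree sequence, summed against the harmonic series.
  Let \<open>H\<close> be a free graph on \<open>n\<close> vertices and let \<open>S\<close> be any nonempty set of \<open>m\<close> of its vertices.
  Cut the vertex set into about \<open>n / m\<close> blocks of size at most \<open>m\<close>. An edge that meets \<open>S\<close> has
  \<open>r - 1\<close> further vertices, so it lies in the union of \<open>S\<close> and \<open>r - 1\<close> blocks. There are
  \<open>O((n / m)^(r - 1))\<close> such unions; each has at most \<open>r * m\<close> vertices and hence, by freeness of the
  induced subgraph, spans \<open>O(m powr (1 + \<alpha>))\<close> edges. Therefore the degrees in \<open>S\<close> add up to
  \<open>O(n^(r - 1) * m powr (2 + \<alpha> - r))\<close>, and the smallest of them is
  \<open>O(n^(r - 1) * m powr (-(r - 1 - \<alpha>)))\<close>. The exponent \<open>p\<close> is exactly the one for which the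
  \<open>p\<close>-th power of this bound is \<open>K / m\<close> with \<open>K = O(n powr (p * (r - 1)))\<close>.

  Since this holds for every \<open>S\<close>, it follows that the \<open>m\<close>-th largest value of \<open>degree powr p\<close>
  is at most \<open>K / m\<close>, and summing over \<open>m = 1, \<dots>, n\<close> gives \<open>K\<close> times the \<open>n\<close>-th harmonic number;
  this is where the logarithm comes from. The two halves are \<open>exists_small_degree\<close> and
  \<open>sum_le_harm\<close>.
\<close>

section \<open>Edges spanned by vertex sets in free graphs\<close>

lemma family_free_induced:
  assumes "family_free \<F> H" and "W \<subseteq> verts H"
  shows "family_free \<F> (W, {e \<in> edges H. e \<subseteq> W})"
  unfolding family_free_def
proof (intro ballI notI)
  fix F assume "F \<in> \<F>" and "contains_copy (W, {e \<in> edges H. e \<subseteq> W}) F"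
  then have "contains_copy H F"
    using assms(2) unfolding contains_copy_def
    by (elim exE conjE, intro exI conjI) auto
  then show False
    using assms(1) \<open>F \<in> \<F>\<close> by (simp add: family_free_def)
qed

lemma card_edges_within_le_ex:
  fixes H :: "nat hypergraph"
  assumes "r_graph r H" and "family_free \<F> H" and "W \<subseteq> verts H"
  shows "card {e \<in> edges H. e \<subseteq> W} \<le> ex r (card W) \<F>"
proof -
  let ?H = "(W, {e \<in> edges H. e \<subseteq> W})"
  have "r_graph r ?H"
    using assms(1,3) finite_subset by (auto simp: r_graph_def)
  then have "?H \<in> free_graphs r (card W) \<F>"
    using family_free_induced[OF assms(2,3)] by (simp add: free_graphs_def)
  then have "card (edges ?H) \<in> (\<lambda>H. card (edges H)) ` free_graphs r (card W) \<F>"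
    by (rule imageI)
  then have "card (edges ?H) \<le> ex r (card W) \<F>"
    unfolding ex_def by (rule Max_ge[OF finite_edge_counts])
  then show ?thesis
    by simp
qed

text \<open>Small arguments are absorbed into the constant, because the subgraphs to which the bound
  is applied need not be large.\<close>

lemma bigo_powr_imp_uniform_bound:
  fixes f :: "nat \<Rightarrow> nat" and s :: real
  assumes "(\<lambda>n. real (f n)) \<in> O(\<lambda>n. real n powr s)" and "s \<ge> 0"
  obtains C where "C > 0" and "\<And>n. n \<ge> 1 \<Longrightarrow> real (f n) \<le> C * real n powr s"
proof -
  obtain c where c: "c > 0" and ev: "eventually (\<lambda>n. norm (real (f n)) \<le> c * norm (real n powr s)) at_top"
    using assms(1) by (elim landau_o.bigE)
  then obtain N where N: "\<And>n. n \<ge> N \<Longrightarrow> real (f n) \<le> c * real n powr s"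
    by (auto simp: eventually_at_top_linorder)
  define C where "C = c + (\<Sum>n<N. real (f n))"
  have sum_nonneg: "(\<Sum>n<N. real (f n)) \<ge> 0"
    by (intro sum_nonneg) simp
  have "real (f n) \<le> C * real n powr s" if "n \<ge> 1" for n
  proof (cases "n \<ge> N")
    case True
    then have "real (f n) \<le> c * real n powr s"
      by (rule N)
    also have "\<dots> \<le> C * real n powr s"
      using sum_nonneg by (intro mult_right_mono) (auto simp: C_def)
    finally show ?thesis .
  next
    case False
    then have "real (f n) \<le> (\<Sum>n<N. real (f n))"
      by (intro member_le_sum) auto
    also have "\<dots> \<le> C * 1"
      using c by (simp add: C_def)
    also have "\<dots> \<le> C * real n powr s"
      using that c sum_nonneg assms(2) by (intro mult_left_mono ge_one_powr_ge_zero) (auto simp: C_def)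
    finally show ?thesis .
  qed
  moreover have "C > 0"
    using c sum_nonneg by (simp add: C_def)
  ultimately show ?thesis
    using that by blast
qed

section \<open>Degree sums over vertex sets\<close>

lemma obtain_block_partition:
  assumes "finite V" and "m \<ge> 1" and "m \<le> card V"
  obtains k :: nat and b :: "'a \<Rightarrow> nat"
  where "real k \<le> 2 * real (card V) / real m"
    and "\<And>v. v \<in> V \<Longrightarrow> b v < k"
    and "\<And>i. card {v \<in> V. b v = i} \<le> m"
proof -
  obtain h where h: "bij_betw h V {0..<card V}"
    using assms(1) ex_bij_betw_finite_nat by blast
  define k where "k = card V div m + 1"
  have "real k \<le> real (card V) / real m + 1"
    by (simp add: k_def of_nat_div_le_of_nat)
  \<comment> \<open>Rounding up costs at most a factor \<open>2\<close> because the quotient is at least \<open>1\<close>.\<close>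
  also have "\<dots> \<le> 2 * real (card V) / real m"
    using assms(2,3) by (simp add: field_simps)
  finally have k: "real k \<le> 2 * real (card V) / real m" .
  have lt: "h v div m < k" if "v \<in> V" for v
  proof -
    have "h v < card V"
      using bij_betwE[OF h] that by auto
    then show ?thesis
      by (simp add: k_def div_le_mono less_Suc_eq_le)
  qed
  have block: "card {v \<in> V. h v div m = i} \<le> m" for i
  proof -
    have "h ` {v \<in> V. h v div m = i} \<subseteq> {i * m..<i * m + m}"
    proof (rule image_subsetI)
      fix v assume "v \<in> {v \<in> V. h v div m = i}"
      then have "h v = i * m + h v mod m"
        by auto
      moreover have "h v mod m < m"
        using assms(2) by simp
      ultimately show "h v \<in> {i * m..<i * m + m}"
        by (metis atLeastLessThan_iff le_add1 nat_add_left_cancel_less)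
    qed
    moreover have "inj_on h {v \<in> V. h v div m = i}"
      using h by (auto simp: bij_betw_def inj_on_def)
    ultimately have "card {v \<in> V. h v div m = i} \<le> card {i * m..<i * m + m}"
      by (intro card_inj_on_le) auto
    then show ?thesis
      by simp
  qed
  show ?thesis
    using that[of k "\<lambda>v. h v div m"] k lt block by blast
qed

text \<open>Counting by a cover instead of by a random vertex set: the unions of \<open>S\<close> with \<open>r - 1\<close> blocks
  of size at most \<open>card S\<close> cover every edge that meets \<open>S\<close>, and each of them is small enough for
  the hypothesis.\<close>

lemma card_edges_meeting_le:
  fixes B :: real
  assumes H: "r_graph r H" and "r \<ge> 1" and S: "S \<subseteq> verts H" "S \<noteq> {}"
    and bound: "\<And>W. W \<subseteq> verts H \<Longrightarrow> W \<noteq> {} \<Longrightarrow> card W \<le> r * card S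
                  \<Longrightarrow> real (card {e \<in> edges H. e \<subseteq> W}) \<le> B"
  shows "real (card {e \<in> edges H. e \<inter> S \<noteq> {}})
           \<le> (2 * real (card (verts H)) / real (card S)) ^ (r - 1) * B"
proof -
  let ?V = "verts H"
  have finV: "finite ?V" and finS: "finite S"
    using H S(1) finite_subset by (auto simp: r_graph_def)
  have S1: "card S \<ge> 1"
    using finS S(2) by (simp add: Suc_leI card_gt_0_iff)
  have SV: "card S \<le> card ?V"
    using finV S(1) by (rule card_mono)
  obtain k and b :: "'a \<Rightarrow> nat" where k: "real k \<le> 2 * real (card ?V) / real (card S)"
    and b: "\<And>v. v \<in> ?V \<Longrightarrow> b v < k" and block: "\<And>i. card {v \<in> ?V. b v = i} \<le> card S"
    using obtain_block_partition[OF finV S1 SV] by metis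
  define L where "L = {is. set is \<subseteq> {..<k} \<and> length is = r - 1}"
  define W where "W is = S \<union> (\<Union>i\<in>set is. {v \<in> ?V. b v = i})" for "is"
  have finL: "finite L" and cardL: "card L = k ^ (r - 1)"
    by (simp_all add: L_def finite_lists_length_eq card_lists_length_eq)
  have W_bound: "real (card {e \<in> edges H. e \<subseteq> W is}) \<le> B" if "is \<in> L" for "is"
  proof (rule bound)
    show "W is \<subseteq> ?V" "W is \<noteq> {}"
      using S by (auto simp: W_def)
    have "card (\<Union>i\<in>set is. {v \<in> ?V. b v = i}) \<le> (\<Sum>i\<in>set is. card {v \<in> ?V. b v = i})"
      by (rule card_UN_le) simp
    also have "\<dots> \<le> card (set is) * card S"
      using sum_bounded_above[of "set is" "\<lambda>i. card {v \<in> ?V. b v = i}" "card S"] block by simp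
    also have "\<dots> \<le> (r - 1) * card S"
      using that card_length[of "is"] by (intro mult_right_mono) (auto simp: L_def)
    finally have "card (W is) \<le> card S + (r - 1) * card S"
      using card_Un_le[of S "\<Union>i\<in>set is. {v \<in> ?V. b v = i}"] by (simp add: W_def)
    also have "\<dots> = r * card S"
      using \<open>r \<ge> 1\<close> by (cases r) auto
    finally show "card (W is) \<le> r * card S" .
  qed
  have cover: "{e \<in> edges H. e \<inter> S \<noteq> {}} \<subseteq> (\<Union>is\<in>L. {e \<in> edges H. e \<subseteq> W is})"
  proof
    fix e assume "e \<in> {e \<in> edges H. e \<inter> S \<noteq> {}}"
    then obtain v where e: "e \<in> edges H" and v: "v \<in> e" "v \<in> S"
      by auto
    have eV: "e \<subseteq> ?V" and "card e = r"
      using H e by (auto simp: r_graph_def)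
    have fine: "finite e"
      using eV finV by (rule finite_subset)
    then obtain xs where xs: "set xs = e - {v}" "distinct xs"
      using finite_distinct_list[of "e - {v}"] by auto
    have "length xs = r - 1"
      using xs distinct_card[OF xs(2)] v(1) fine \<open>card e = r\<close> by simp
    then have "map b xs \<in> L"
      using xs(1) eV b by (auto simp: L_def)
    moreover have "e \<subseteq> W (map b xs)"
      using xs(1) eV v(2) by (auto simp: W_def)
    ultimately show "e \<in> (\<Union>is\<in>L. {e \<in> edges H. e \<subseteq> W is})"
      using e by auto
  qed
  have "card {e \<in> edges H. e \<inter> S \<noteq> {}} \<le> card (\<Union>is\<in>L. {e \<in> edges H. e \<subseteq> W is})"
    using finL r_graph_finite_edges(1)[OF H] by (intro card_mono cover) auto
  also have "\<dots> \<le> (\<Sum>is\<in>L. card {e \<in> edges H. e \<subseteq> W is})"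
    by (rule card_UN_le[OF finL])
  finally have "real (card {e \<in> edges H. e \<inter> S \<noteq> {}})
      \<le> (\<Sum>is\<in>L. real (card {e \<in> edges H. e \<subseteq> W is}))"
    by (simp flip: of_nat_sum)
  also have "\<dots> \<le> real (card L) * B"
    using sum_bounded_above[of L "\<lambda>is. real (card {e \<in> edges H. e \<subseteq> W is})" B] W_bound by simp
  also have "\<dots> = real k ^ (r - 1) * B"
    by (simp add: cardL)
  also have "\<dots> \<le> (2 * real (card ?V) / real (card S)) ^ (r - 1) * B"
  proof -
    have "card S \<le> r * card S"
      using \<open>r \<ge> 1\<close> by simp
    then have "0 \<le> B"
      using bound[of S] S by linarith
    then show ?thesis
      using k by (intro mult_right_mono power_mono) auto
  qed
  finally show ?thesis .
qed

lemma sum_degree_le: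
  assumes H: "r_graph r H" and S: "S \<subseteq> verts H"
  shows "(\<Sum>v\<in>S. degree H v) \<le> r * card {e \<in> edges H. e \<inter> S \<noteq> {}}"
proof -
  let ?E = "{e \<in> edges H. e \<inter> S \<noteq> {}}"
  have finS: "finite S" and finE: "finite ?E"
    using H S finite_subset r_graph_finite_edges(1)[OF H] by (auto simp: r_graph_def)
  have "(\<Sum>v\<in>S. degree H v) = (\<Sum>v\<in>S. card {e \<in> ?E. v \<in> e})"
    unfolding degree_def by (intro sum.cong arg_cong[where f = card]) auto
  also have "\<dots> = (\<Sum>e\<in>?E. card {v \<in> S. v \<in> e})"
    using sum.swap_restrict[OF finS finE, of "\<lambda>_ _. 1::nat" "\<lambda>v e. v \<in> e"] by simp
  also have "\<dots> \<le> of_nat (card ?E) * r"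
  proof (rule sum_bounded_above)
    fix e assume "e \<in> ?E"
    then have "card e = r" "finite e"
      using H finite_subset by (auto simp: r_graph_def)
    then show "card {v \<in> S. v \<in> e} \<le> r"
      using card_mono[of e "{v \<in> S. v \<in> e}"] by auto
  qed
  finally show ?thesis
    by (simp add: mult.commute)
qed

section \<open>From the weak-type bound to the norm\<close>

text \<open>The witness is a vertex of minimal degree in \<open>S\<close>, whose degree is at most the average. The bound
  on this average is proportional to \<open>card S powr (-(r - 1 - \<alpha>))\<close>, whose \<open>p\<close>-th power is
  \<open>1 / card S\<close>.\<close>

lemma exists_small_degree:
  fixes H :: "nat hypergraph" and \<alpha> p C :: real
  assumes "r \<ge> 1" and "\<alpha> \<ge> -1" and "\<alpha> < real r - 1" and p: "p = 1 / (real r - 1 - \<alpha>)"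
    and "C > 0" and ex_le: "\<And>n. n \<ge> 1 \<Longrightarrow> real (ex r n \<F>) \<le> C * real n powr (1 + \<alpha>)"
    and H: "r_graph r H" and free: "family_free \<F> H"
    and S: "S \<subseteq> verts H" "S \<noteq> {}"
  shows "\<exists>v\<in>S. real (card S) * real (degree H v) powr p
           \<le> (real r * 2 ^ (r - 1) * C * real r powr (1 + \<alpha>)) powr p
              * real (card (verts H)) powr (p * (real r - 1))"
proof -
  let ?n = "real (card (verts H))" and ?m = "real (card S)"
  define D where "D = real r * 2 ^ (r - 1) * C * real r powr (1 + \<alpha>)"
  have finV: "finite (verts H)" and finS: "finite S"
    using H S(1) finite_subset by (auto simp: r_graph_def)
  have m_pos: "?m > 0"
    using finS S(2) by (simp add: card_gt_0_iff)
  have n_pos: "?n > 0"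
    using m_pos card_mono[OF finV S(1)] by simp
  have p_pos: "p > 0"
    using assms(3) p by simp
  have D_pos: "D > 0"
    using assms(1,5) by (simp add: D_def)
  have meeting: "real (card {e \<in> edges H. e \<inter> S \<noteq> {}})
      \<le> (2 * ?n / ?m) ^ (r - 1) * (C * (real r * ?m) powr (1 + \<alpha>))"
  proof (rule card_edges_meeting_le[OF H \<open>r \<ge> 1\<close> S])
    fix W assume W: "W \<subseteq> verts H" "W \<noteq> {}" "card W \<le> r * card S"
    have "card W \<ge> 1"
      using W(1,2) finV finite_subset by (fastforce simp: Suc_le_eq card_gt_0_iff)
    have "real (card {e \<in> edges H. e \<subseteq> W}) \<le> real (ex r (card W) \<F>)"
      using card_edges_within_le_ex[OF H free W(1)] by simp
    also have "\<dots> \<le> C * real (card W) powr (1 + \<alpha>)"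
      by (rule ex_le) fact
    also have "\<dots> \<le> C * (real r * ?m) powr (1 + \<alpha>)"
    proof -
      have "real (card W) \<le> real r * ?m"
        using W(3) by (metis of_nat_le_iff of_nat_mult)
      then show ?thesis
        using assms(2,5) by (intro mult_left_mono powr_mono2) auto
    qed
    finally show "real (card {e \<in> edges H. e \<subseteq> W}) \<le> C * (real r * ?m) powr (1 + \<alpha>)" .
  qed
  obtain v where v: "v \<in> S" "\<And>w. w \<in> S \<Longrightarrow> degree H v \<le> degree H w"
    using ex_is_arg_min_if_finite[OF finS S(2), of "degree H"]
    by (auto simp: is_arg_min_linorder)
  let ?d = "real (degree H v)"
  have "?m * ?d \<le> real (\<Sum>w\<in>S. degree H w)"
    using sum_bounded_below[of S "degree H v" "degree H"] v(2)
    by (metis of_nat_id of_nat_le_iff of_nat_mult)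
  also have "\<dots> \<le> real r * real (card {e \<in> edges H. e \<inter> S \<noteq> {}})"
    using sum_degree_le[OF H S(1)] by (metis of_nat_le_iff of_nat_mult)
  also have "\<dots> \<le> real r * ((2 * ?n / ?m) ^ (r - 1) * (C * (real r * ?m) powr (1 + \<alpha>)))"
    using meeting by (rule mult_left_mono) simp
  also have "\<dots> = D * (?n ^ (r - 1) * (?m powr (1 + \<alpha>) / ?m ^ (r - 1)))"
    by (simp add: D_def powr_mult power_divide power_mult_distrib)
  also have "?n ^ (r - 1) = ?n powr (real r - 1)"
    using n_pos \<open>r \<ge> 1\<close> by (simp add: powr_realpow[symmetric] of_nat_diff)
  also have "?m ^ (r - 1) = ?m powr (real r - 1)"
    using m_pos \<open>r \<ge> 1\<close> by (simp add: powr_realpow[symmetric] of_nat_diff)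
  also have "?m powr (1 + \<alpha>) / ?m powr (real r - 1) = ?m * ?m powr (- (real r - 1 - \<alpha>))"
    using m_pos powr_add[of ?m 1 "- (real r - 1 - \<alpha>)"] by (simp add: powr_diff[symmetric] algebra_simps)
  finally have "?m * ?d \<le> ?m * (D * ?n powr (real r - 1) * ?m powr (- (real r - 1 - \<alpha>)))"
    by (simp only: mult_ac)
  then have "?d \<le> D * ?n powr (real r - 1) * ?m powr (- (real r - 1 - \<alpha>))"
    using m_pos by simp
  then have "?d powr p \<le> (D * ?n powr (real r - 1) * ?m powr (- (real r - 1 - \<alpha>))) powr p"
    using p_pos by (intro powr_mono2) auto
  also have "\<dots> = D powr p * ?n powr ((real r - 1) * p) * ?m powr (- (real r - 1 - \<alpha>) * p)"
    using D_pos by (simp add: powr_mult powr_powr)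
  also have "- (real r - 1 - \<alpha>) * p = -1"
    using assms(3) by (simp add: p field_simps)
  finally have "?d powr p \<le> D powr p * ?n powr (p * (real r - 1)) / ?m"
    using m_pos by (simp add: powr_minus divide_inverse mult.commute)
  then have "?m * ?d powr p \<le> D powr p * ?n powr (p * (real r - 1))"
    using m_pos by (simp add: field_simps)
  then show ?thesis
    using v(1) by (auto simp: D_def)
qed

text \<open>Repeatedly remove the element given by the hypothesis for the set that is left: the one removed
  from a set of \<open>j\<close> elements has value at most \<open>K / j\<close>.\<close>

lemma sum_le_harm:
  fixes f :: "'a \<Rightarrow> real"
  assumes "finite V" and "\<And>S. S \<subseteq> V \<Longrightarrow> S \<noteq> {} \<Longrightarrow> \<exists>v\<in>S. real (card S) * f v \<le> K"
  shows "sum f V \<le> K * harm (card V)"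
  using assms
proof (induction "card V" arbitrary: V)
  case 0
  then show ?case
    by (simp add: harm_def)
next
  case (Suc j)
  then have "V \<noteq> {}"
    by auto
  then obtain v where v: "v \<in> V" "real (card V) * f v \<le> K"
    using Suc.prems(2)[of V] by auto
  have "sum f (V - {v}) \<le> K * harm (card (V - {v}))"
  proof (rule Suc.hyps(1))
    show "j = card (V - {v})"
      using Suc.hyps(2) Suc.prems(1) v(1) by simp
    show "\<exists>v\<in>S. real (card S) * f v \<le> K" if "S \<subseteq> V - {v}" "S \<noteq> {}" for S
      using that Suc.prems(2)[of S] by blast
  qed (use Suc.prems(1) in simp)
  also have "card (V - {v}) = j"
    using Suc.hyps(2) Suc.prems(1) v(1) by simp
  finally have "sum f (V - {v}) \<le> K * harm j" .
  moreover have "f v \<le> K * inverse (real (Suc j))"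
    using v(2) Suc.hyps(2) by (simp add: field_simps)
  moreover have "sum f V = f v + sum f (V - {v})"
    using Suc.prems(1) v(1) by (rule sum.remove)
  ultimately show ?case
    by (simp add: harm_Suc Suc.hyps(2)[symmetric] algebra_simps)
qed

lemma harm_le_log2:
  assumes "n \<ge> 2"
  shows "harm n \<le> 2 * log 2 (real n)"
proof -
  have "harm n \<le> ln (real n) + (1::real)"
    using decseqD[OF decseq_harm_diff_ln, of 0 "n - 1"] assms by (simp add: harm_expand)
  moreover have "ln (real n) \<le> log 2 (real n)"
  proof -
    have "0 < ln (2::real)" "ln (2::real) \<le> 1"
      using ln_le_minus_one[of 2] by auto
    then show ?thesis
      using assms by (simp add: log_def field_simps mult_left_le)
  qed
  moreover have "1 \<le> log 2 (real n)"
    using assms by (simp add: le_log_iff)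
  ultimately show ?thesis
    by simp
qed

theorem theorem1p3:
  fixes r :: nat and \<alpha> p :: real and \<F> :: "'a hypergraph set"
  assumes "r \<ge> 2"
    and "\<And>F. F \<in> \<F> \<Longrightarrow> r_graph r F"
    and "degenerate r \<F>"
    and "real r - 2 \<le> \<alpha>" and "\<alpha> < real r - 1"
    and "(\<lambda>n. real (ex r n \<F>)) \<in> O(\<lambda>n. real n powr (1 + \<alpha>))"
    and "p = 1 / (real r - 1 - \<alpha>)"
  shows "(\<lambda>n. ex_norm r p n \<F>) \<in> O(\<lambda>n. real n powr (p * (real r - 1)) * log 2 (real n))"
proof -
  have r1: "r \<ge> 1" and \<alpha>: "\<alpha> \<ge> -1" "1 + \<alpha> \<ge> 0"
    using assms(1,4) by auto
  obtain C where C: "C > 0" and ex_le: "\<And>n. n \<ge> 1 \<Longrightarrow> real (ex r n \<F>) \<le> C * real n powr (1 + \<alpha>)"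
    using bigo_powr_imp_uniform_bound[OF assms(6) \<alpha>(2)] by blast
  define A where "A = (real r * 2 ^ (r - 1) * C * real r powr (1 + \<alpha>)) powr p"
  define g where "g n = real n powr (p * (real r - 1)) * log 2 (real n)" for n
  \<comment> \<open>When there are no free graphs, \<open>ex_norm\<close> is the unspecified number \<open>Max {}\<close>. It is the same
      for all \<open>n\<close>, so it can be part of the constant.\<close>
  define M where "M = \<bar>Max ({} :: real set)\<bar>"
  have "norm (ex_norm r p n \<F>) \<le> (2 * A + M) * norm (g n)" if n: "n \<ge> 2" for n
  proof -
    have "p * (real r - 1) \<ge> 0"
      using assms(1,5,7) by simp
    then have "1 \<le> real n powr (p * (real r - 1))"
      using n by (intro ge_one_powr_ge_zero) auto
    moreover have "1 \<le> log 2 (real n)"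
      using n by (simp add: le_log_iff)
    ultimately have g1: "1 \<le> g n"
      using mult_mono[of 1 "real n powr (p * (real r - 1))" 1 "log 2 (real n)"] by (simp add: g_def)
    have AM: "A \<ge> 0" "M \<ge> 0"
      by (auto simp: A_def M_def)
    show ?thesis
    proof (cases "free_graphs r n \<F> = {}")
      case True
      then have "norm (ex_norm r p n \<F>) \<le> M * 1"
        by (simp add: ex_norm_def M_def)
      also have "\<dots> \<le> (2 * A + M) * g n"
        using AM g1 by (intro mult_mono) auto
      finally show ?thesis
        using g1 by simp
    next
      case False
      then have "ex_norm r p n \<F> \<in> degree_norm p ` free_graphs r n \<F>"
        unfolding ex_norm_def by (intro Max_in finite_degree_norms) simp
      then obtain H :: "nat hypergraph"
        where "H \<in> free_graphs r n \<F>" and eq: "ex_norm r p n \<F> = degree_norm p H"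
        by blast
      then have H: "r_graph r H" "card (verts H) = n" "family_free \<F> H"
        by (simp_all add: free_graphs_def)
      have "degree_norm p H \<le> A * real n powr (p * (real r - 1)) * harm (card (verts H))"
        unfolding degree_norm_def
      proof (rule sum_le_harm)
        show "finite (verts H)"
          using H(1) by (simp add: r_graph_def)
        fix S assume "S \<subseteq> verts H" "S \<noteq> {}"
        then show "\<exists>v\<in>S. real (card S) * real (degree H v) powr p
                     \<le> A * real n powr (p * (real r - 1))"
          using exists_small_degree[OF r1 \<alpha>(1) assms(5,7) C ex_le H(1,3)]
          unfolding A_def H(2) by blast
      qed
      also have "\<dots> \<le> A * real n powr (p * (real r - 1)) * (2 * log 2 (real n))"
        unfolding H(2) using harm_le_log2[OF n] AM by (intro mult_left_mono) auto
      also have "\<dots> = 2 * A * g n"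
        by (simp add: g_def)
      also have "\<dots> \<le> (2 * A + M) * g n"
        using AM g1 by (intro mult_right_mono) auto
      finally have "degree_norm p H \<le> (2 * A + M) * g n" .
      moreover have "degree_norm p H \<ge> 0"
        unfolding degree_norm_def by (intro sum_nonneg) simp
      ultimately show ?thesis
        using g1 eq by simp
    qed
  qed
  then have "(\<lambda>n. ex_norm r p n \<F>) \<in> O(g)"
    by (intro bigoI[of _ "2 * A + M"] eventually_at_top_linorderI[of 2])
  then show ?thesis
    by (simp add: g_def[abs_def])
qed

end
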